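(* Let $\mathbb{F}_q$ be a finite field with $q$ elements and let $L$ be the three-dimensional abelian Lie algebra over $\mathbb{F}_q$. Then the number of triangles in the comaximal graph $\Gamma(L)$ is $$\mathfrak{t}(\Gamma(L)) = \frac{q(q+1)(4q^4+2q^3+q^2-3q-1)}{6}.$$
   Context: For a finite-dimensional Lie algebra $L$, the comaximal graph $\Gamma(L)$ is the simple undirected graph whose vertices are the proper nonzero Lie subalgebras of $L$; two distinct vertices $A,B$ are adjacent if and only if the Lie subalgebra $\langle A,B\rangle$ generated by $A\cup B$ equals $L$. A triangle of a graph is a set of three pairwise adjacent vertices, and $\mathfrak{t}(\Gamma)$ denotes the number of triangles of $\Gamma$. *)

theory Defs
  imports Complex_Main "HOL-Library.Cardinality"
begin

text \<open>The underlying space of the Lie algebra is the whole type \<open>'l\<close>. Anticommutativity is stated in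
  its alternating form \<open>[x, x] = 0\<close>, the correct one in characteristic 2.\<close>

locale lie_algebra = vector_space scale
  for scale :: "'k::field \<Rightarrow> 'l::ab_group_add \<Rightarrow> 'l" +
  fixes bracket :: "'l \<Rightarrow> 'l \<Rightarrow> 'l"
  assumes bracket_add_left: "bracket (x + y) z = bracket x z + bracket y z"
    and bracket_add_right: "bracket x (y + z) = bracket x y + bracket x z"
    and bracket_scale_left: "bracket (scale c x) y = scale c (bracket x y)"
    and bracket_scale_right: "bracket x (scale c y) = scale c (bracket x y)"
    and bracket_alternating: "bracket x x = 0"
    and jacobi: "bracket x (bracket y z) + bracket y (bracket z x) + bracket z (bracket x y) = 0"
begin

definition abelian :: bool where
  "abelian \<longleftrightarrow> (\<forall>x y. bracket x y = 0)"

definition lie_subalgebra :: "'l set \<Rightarrow> bool" where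
  "lie_subalgebra S \<longleftrightarrow> subspace S \<and> (\<forall>x\<in>S. \<forall>y\<in>S. bracket x y \<in> S)"

definition lie_span :: "'l set \<Rightarrow> 'l set" where
  "lie_span X = lie_subalgebra hull X"

definition comaximal_vertices :: "'l set set" where
  "comaximal_vertices = {A. lie_subalgebra A \<and> A \<noteq> {0} \<and> A \<noteq> UNIV}"

definition comaximal_edges :: "'l set set set" where
  "comaximal_edges = {{A, B} | A B. A \<in> comaximal_vertices \<and> B \<in> comaximal_vertices \<and>
     A \<noteq> B \<and> lie_span (A \<union> B) = UNIV}"

text \<open>A simple undirected graph is a pair of a vertex set and a set of two-element edges.\<close>

definition comaximal_graph :: "'l set set \<times> 'l set set set" where
  "comaximal_graph = (comaximal_vertices, comaximal_edges)"

end

definition triangles :: "'v set \<times> 'v set set \<Rightarrow> 'v set set" where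
  "triangles G = {T. T \<subseteq> fst G \<and> card T = 3 \<and> (\<forall>a\<in>T. \<forall>b\<in>T. a \<noteq> b \<longrightarrow> {a, b} \<in> snd G)}"

definition num_triangles :: "'v set \<times> 'v set set \<Rightarrow> nat" where
  "num_triangles G = card (triangles G)"

end

theory Submission
  imports Defs
begin

text \<open>All subspaces are subalgebras. With \<open>N = q\<^sup>2 + q + 1\<close>, the space has \<open>N\<close>
  planes; two lines are never adjacent, two distinct planes always are, and a line is adjacent to a
  plane iff it is not contained in it. So a triangle consists of three planes, or of two planes and
  a line outside their union. Two distinct planes cover \<open>2 q\<^sup>2 - q\<close> vectors, which leaves
  \<open>q (q - 1)\<^sup>2\<close> vectors, that is \<open>q\<^sup>2 - q\<close> lines, so there are \<open>(N choose 3) + (N choose 2) (q\<^sup>2 - q)\<close>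
  triangles.\<close>

section \<open>Triangles in a graph split into an independent set and a clique\<close>

text \<open>Independence of \<open>A\<close> leaves room for at most one vertex of \<open>A\<close>
  in a triangle. The other two vertices then form a pair in \<open>B\<close>, and \<open>m\<close>
  counts the choices of the third one.\<close>

lemma num_triangles_split:
  assumes "finite A" "finite B" "A \<inter> B = {}"
    and indep: "\<And>a a'. \<lbrakk>a \<in> A; a' \<in> A; a \<noteq> a'\<rbrakk> \<Longrightarrow> {a, a'} \<notin> E"
    and clique: "\<And>b b'. \<lbrakk>b \<in> B; b' \<in> B; b \<noteq> b'\<rbrakk> \<Longrightarrow> {b, b'} \<in> E"
    and common: "\<And>b b'. \<lbrakk>b \<in> B; b' \<in> B; b \<noteq> b'\<rbrakk> \<Longrightarrow>
      card {a \<in> A. {a, b} \<in> E \<and> {a, b'} \<in> E} = m"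
  shows "num_triangles (A \<union> B, E) = (card B choose 3) + (card B choose 2) * m"
proof -
  define T3 where "T3 = {T. T \<subseteq> B \<and> card T = 3}"
  define D where "D = {T. T \<subseteq> B \<and> card T = 2}"
  define M where "M T = {a \<in> A. \<forall>b\<in>T. {a, b} \<in> E}" for T
  \<comment> \<open>Building the mixed triangles as an image of (pair, common neighbour) turns their
    number into a sum over \<open>D\<close>, once the map is known to be injective.\<close>
  define T2 where "T2 = (\<lambda>(T, a). insert a T) ` Sigma D M"
  have finD: "finite D" unfolding D_def using \<open>finite B\<close> by simp
  have finM: "finite (M T)" for T unfolding M_def using \<open>finite A\<close> by simp
  have "T \<in> triangles (A \<union> B, E) \<longleftrightarrow> T \<in> T3 \<union> T2" for T
  proof
    assume T: "T \<in> triangles (A \<union> B, E)"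
    then have sub: "T \<subseteq> A \<union> B" and c3: "card T = 3"
      and adj: "\<And>a b. \<lbrakk>a \<in> T; b \<in> T; a \<noteq> b\<rbrakk> \<Longrightarrow> {a, b} \<in> E"
      by (auto simp: triangles_def)
    show "T \<in> T3 \<union> T2"
    proof (cases "T \<subseteq> B")
      case True
      then show ?thesis using c3 by (simp add: T3_def)
    next
      case False
      then obtain a where a: "a \<in> T" "a \<in> A" "a \<notin> B" using sub by blast
      have "T - {a} \<subseteq> B"
        using sub adj indep a by blast
      moreover have "card (T - {a}) = 2" using c3 a by simp
      ultimately have "T - {a} \<in> D" by (simp add: D_def)
      moreover have "a \<in> M (T - {a})" using a adj by (auto simp: M_def)
      ultimately have "(\<lambda>(T, a). insert a T) (T - {a}, a) \<in> T2"
        unfolding T2_def by blast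
      then show ?thesis using a by (simp add: insert_absorb)
    qed
  next
    assume "T \<in> T3 \<union> T2"
    then show "T \<in> triangles (A \<union> B, E)"
    proof
      assume "T \<in> T3"
      then show ?thesis using clique by (auto simp: T3_def triangles_def)
    next
      assume "T \<in> T2"
      then obtain S a where T: "T = insert a S" and S: "S \<subseteq> B" "card S = 2"
        and a: "a \<in> A" "\<And>b. b \<in> S \<Longrightarrow> {a, b} \<in> E"
        by (auto simp: T2_def D_def M_def)
      have "a \<notin> S" using S a \<open>A \<inter> B = {}\<close> by blast
      moreover have "finite S" using S \<open>finite B\<close> finite_subset by blast
      ultimately have "card T = 3" using S T by simp
      moreover have "T \<subseteq> A \<union> B" using T S a by blast
      moreover have "{x, y} \<in> E" if "x \<in> T" "y \<in> T" "x \<noteq> y" for x y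
        using that T a(2) clique S(1) by (metis insert_commute insert_iff subsetD)
      ultimately show ?thesis by (simp add: triangles_def)
    qed
  qed
  then have eq: "triangles (A \<union> B, E) = T3 \<union> T2" by blast
  have inj: "inj_on (\<lambda>(T, a). insert a T) (Sigma D M)"
  proof (rule inj_onI, clarify)
    fix S a S' a'
    assume S: "S \<in> D" "a \<in> M S" "S' \<in> D" "a' \<in> M S'" and e: "insert a S = insert a' S'"
    \<comment> \<open>The triangle determines both of its components by intersection with
      \<open>B\<close> and with \<open>A\<close>.\<close>
    have "a \<in> A" "a' \<in> A" "S \<subseteq> B" "S' \<subseteq> B" using S by (auto simp: M_def D_def)
    with \<open>A \<inter> B = {}\<close> have "insert a S \<inter> B = S" "insert a S \<inter> A = {a}"
      "insert a' S' \<inter> B = S'" "insert a' S' \<inter> A = {a'}"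
      by blast+
    with e show "S = S' \<and> a = a'" by auto
  qed
  have M: "card (M T) = m" if "T \<in> D" for T
  proof -
    have "card T = 2" using that by (simp add: D_def)
    then obtain b b' where T: "T = {b, b'}" "b \<noteq> b'" unfolding card_2_iff by blast
    then have "b \<in> B" "b' \<in> B" using that by (auto simp: D_def)
    then have "card {a \<in> A. {a, b} \<in> E \<and> {a, b'} \<in> E} = m" using T common by blast
    then show ?thesis by (simp add: M_def T)
  qed
  have "card T2 = (\<Sum>T\<in>D. card (M T))"
    unfolding T2_def by (simp add: card_image[OF inj] finD finM)
  also have "\<dots> = card D * m" using M by simp
  also have "card D = card B choose 2" unfolding D_def by (rule n_subsets[OF \<open>finite B\<close>])
  finally have "card T2 = (card B choose 2) * m" .
  moreover have "card T3 = card B choose 3" unfolding T3_def by (rule n_subsets[OF \<open>finite B\<close>])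
  moreover have "T3 \<inter> T2 = {}"
    using \<open>A \<inter> B = {}\<close> by (auto simp: T3_def T2_def M_def)
  moreover have "finite T2" unfolding T2_def using finD finM by simp
  moreover have "finite T3" unfolding T3_def using \<open>finite B\<close> by simp
  ultimately show ?thesis
    by (simp add: num_triangles_def eq card_Un_disjoint)
qed

section \<open>Counting vectors, lines and planes over a finite field\<close>

text \<open>No bracket appears: in the abelian case the problem is purely linear.\<close>

locale finite_field_space = finite_dimensional_vector_space scale Basis
  for scale :: "'k::{field,finite} \<Rightarrow> 'l::ab_group_add \<Rightarrow> 'l" (infixr \<open>*s\<close> 75)
    and Basis :: "'l set"
begin

text \<open>Lines and planes are \<open>grassmannian 1\<close> and \<open>grassmannian 2\<close>;
  all of them pass through 0.\<close>

definition grassmannian :: "nat \<Rightarrow> 'l set set" where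
  "grassmannian d = {S. subspace S \<and> dim S = d}"

text \<open>A new basis vector \<open>b\<close> contributes a free coordinate: the vectors of the
  larger span are uniquely \<open>k *s b + x\<close> with \<open>x\<close> in the old span.
  Finiteness goes through the same induction, since nothing is known yet about the size of
  \<open>'l\<close>.\<close>

lemma card_span_independent:
  assumes "finite B" "independent B"
  shows "finite (span B) \<and> card (span B) = CARD('k) ^ card B"
  using assms
proof (induction B)
  case empty
  then show ?case by simp
next
  case (insert b B)
  then have b: "b \<notin> span B" and IH: "finite (span B)" "card (span B) = CARD('k) ^ card B"
    by (auto simp: independent_insert)
  let ?f = "\<lambda>(k, x). k *s b + x"
  have inj: "inj_on ?f (UNIV \<times> span B)"
  proof (rule inj_onI, clarify)
    fix k x k' x'
    assume x: "x \<in> span B" "x' \<in> span B" and e: "k *s b + x = k' *s b + x'"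
    then have "(k - k') *s b = x' - x" by (simp add: algebra_simps scale_left_diff_distrib)
    then have "(k - k') *s b \<in> span B" using x by (simp add: span_diff)
    \<comment> \<open>Otherwise division by \<open>k - k'\<close> would put \<open>b\<close> into
      \<open>span B\<close>.\<close>
    then have "k = k'"
      using b by (metis left_inverse right_minus_eq scale_one scale_scale span_scale)
    then show "k = k' \<and> x = x'" using e by simp
  qed
  have "span (insert b B) = ?f ` (UNIV \<times> span B)"
  proof (intro set_eqI iffI)
    fix x assume "x \<in> span (insert b B)"
    then obtain k where "x - k *s b \<in> span B" by (auto simp: span_insert)
    then have "?f (k, x - k *s b) \<in> ?f ` (UNIV \<times> span B)" by blast
    then show "x \<in> ?f ` (UNIV \<times> span B)" by simp
  next
    fix x assume "x \<in> ?f ` (UNIV \<times> span B)"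
    then obtain k y where "y \<in> span B" "x = k *s b + y" by auto
    then show "x \<in> span (insert b B)" by (auto simp: span_insert intro!: exI[of _ k])
  qed
  then show ?case
    using inj IH insert.hyps by (simp add: card_image card_cartesian_product)
qed

lemma finite_UNIV_space: "finite (UNIV :: 'l set)"
  using card_span_independent[OF finite_Basis independent_Basis] by (simp add: span_Basis)

lemma finite_vectors [simp]: "finite (S :: 'l set)"
  by (rule finite_subset[OF subset_UNIV finite_UNIV_space])

lemma finite_vector_sets [simp]: "finite (F :: 'l set set)"
  by (rule finite_subset[OF subset_UNIV]) (simp add: Finite_Set.finite_set)

lemma card_subspace: "subspace S \<Longrightarrow> card S = CARD('k) ^ dim S"
  by (metis basis_subspace_exists card_span_independent)

lemma span_singleton_eq_line:
  assumes "L \<in> grassmannian 1" "x \<in> L" "x \<noteq> 0"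
  shows "span {x} = L"
  using assms by (intro subspace_dim_equal) (auto simp: grassmannian_def span_minimal)

text \<open>An independent pair in a plane already spans it, so distinct planes share no such
  pair.\<close>

lemma span_pair_eq_plane:
  assumes "P \<in> grassmannian 2" "x \<in> P" "x \<noteq> 0" "y \<in> P" "y \<notin> span {x}"
  shows "span {x, y} = P"
proof (rule subspace_dim_equal)
  have "dim {y, x} = 2" using assms by (simp add: dim_insert)
  then show "dim P \<le> dim (span {x, y})" using assms by (simp add: grassmannian_def insert_commute)
  show "span {x, y} \<subseteq> P" using assms by (intro span_minimal) (auto simp: grassmannian_def)
qed (use assms in \<open>auto simp: grassmannian_def\<close>)

lemma span_singleton_in_grassmannian: "x \<noteq> 0 \<Longrightarrow> span {x} \<in> grassmannian 1"
  by (simp add: grassmannian_def)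

text \<open>Such a set is a disjoint union of lines with 0 removed, each holding
  \<open>CARD('k) - 1\<close> vectors. The product form avoids division of naturals.\<close>

lemma card_lines_scaling_closed:
  assumes "0 \<notin> X" and closed: "\<And>c x. \<lbrakk>c \<noteq> 0; x \<in> X\<rbrakk> \<Longrightarrow> c *s x \<in> X"
  shows "(CARD('k) - 1) * card {L \<in> grassmannian 1. L - {0} \<subseteq> X} = card X"
proof -
  let ?G = "{L \<in> grassmannian 1. L - {0} \<subseteq> X}"
  have "X = (\<Union>L\<in>?G. L - {0})"
  proof
    show "X \<subseteq> (\<Union>L\<in>?G. L - {0})"
    proof
      fix x assume x: "x \<in> X"
      then have "x \<noteq> 0" using \<open>0 \<notin> X\<close> by blast
      moreover have "span {x} - {0} \<subseteq> X" using x closed by (force simp: span_singleton)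
      ultimately show "x \<in> (\<Union>L\<in>?G. L - {0})"
        using span_singleton_in_grassmannian by (auto intro!: exI[of _ "span {x}"] span_base)
    qed
  qed auto
  then have "card X = card (\<Union>L\<in>?G. L - {0})" by simp
  also have "\<dots> = (\<Sum>L\<in>?G. card (L - {0}))"
  proof (rule card_UN_disjoint)
    show "\<forall>L\<in>?G. \<forall>L'\<in>?G. L \<noteq> L' \<longrightarrow> (L - {0}) \<inter> (L' - {0}) = {}"
      using span_singleton_eq_line by blast
  qed auto
  also have "\<dots> = (\<Sum>L\<in>?G. CARD('k) - 1)"
    by (rule sum.cong) (auto simp: grassmannian_def card_subspace subspace_0 card_Diff_singleton)
  finally show ?thesis by (simp add: mult.commute)
qed

text \<open>For a plane these are its ordered bases.\<close>

definition independent_pairs :: "'l set \<Rightarrow> ('l \<times> 'l) set" where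
  "independent_pairs S = (SIGMA x:S - {0}. S - span {x})"

lemma card_independent_pairs:
  assumes "subspace S"
  shows "card (independent_pairs S) =
    (CARD('k) ^ dim S - 1) * (CARD('k) ^ dim S - CARD('k))"
proof -
  have "card (S - span {x}) = CARD('k) ^ dim S - CARD('k)" if "x \<in> S - {0}" for x
  proof -
    have "span {x} \<subseteq> S" using that assms by (simp add: span_minimal)
    then show ?thesis using that assms
      by (simp add: card_Diff_subset card_subspace)
  qed
  then show ?thesis unfolding independent_pairs_def
    using assms by (simp add: card_subspace subspace_0 card_Diff_singleton)
qed

text \<open>Double counting of ordered independent pairs: each of them lies in exactly one plane,
  namely its span.\<close>

lemma card_planes:
  "(CARD('k)\<^sup>2 - 1) * (CARD('k)\<^sup>2 - CARD('k)) * card (grassmannian 2) =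
    (CARD('k) ^ dim (UNIV :: 'l set) - 1) * (CARD('k) ^ dim (UNIV :: 'l set) - CARD('k))"
proof -
  have "independent_pairs UNIV = (\<Union>P\<in>grassmannian 2. independent_pairs P)"
  proof
    show "independent_pairs UNIV \<subseteq> (\<Union>P\<in>grassmannian 2. independent_pairs P)"
    proof clarify
      fix x y assume "(x, y) \<in> independent_pairs UNIV"
      then have xy: "x \<noteq> 0" "y \<notin> span {x}" by (auto simp: independent_pairs_def)
      then have "dim {y, x} = 2" by (simp add: dim_insert)
      then have "span {x, y} \<in> grassmannian 2" by (simp add: grassmannian_def insert_commute)
      moreover have "(x, y) \<in> independent_pairs (span {x, y})"
        using xy by (simp add: independent_pairs_def span_base)
      ultimately show "(x, y) \<in> (\<Union>P\<in>grassmannian 2. independent_pairs P)" by blast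
    qed
  qed (auto simp: independent_pairs_def)
  then have "card (independent_pairs UNIV) = card (\<Union>P\<in>grassmannian 2. independent_pairs P)" by simp
  also have "\<dots> = (\<Sum>P\<in>grassmannian 2. card (independent_pairs P))"
    by (rule card_UN_disjoint)
      (auto simp: independent_pairs_def dest: span_pair_eq_plane)
  also have "\<dots> = (\<Sum>P\<in>grassmannian 2. (CARD('k)\<^sup>2 - 1) * (CARD('k)\<^sup>2 - CARD('k)))"
    by (rule sum.cong) (auto simp: grassmannian_def card_independent_pairs)
  finally show ?thesis by (simp add: card_independent_pairs mult.commute)
qed

section \<open>Incidence of lines and planes in dimension three\<close>

text \<open>A plane has codimension one here, so any strictly larger span is the whole
  space.\<close>

lemma span_Un_plane:
  assumes "dim (UNIV :: 'l set) = 3" "P \<in> grassmannian 2" "\<not> A \<subseteq> P"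
  shows "span (A \<union> P) = UNIV"
proof -
  have "P = span P" using assms by (metis (mono_tags) grassmannian_def mem_Collect_eq span_eq_iff)
  then have "span P \<subset> span (A \<union> P)"
    using assms(3) span_superset[of "A \<union> P"] span_mono[of P "A \<union> P"] by blast
  then have "dim P < dim (A \<union> P)" by (rule dim_psubset)
  then show ?thesis
    using assms dim_subset_UNIV[of "A \<union> P"] dim_eq_full[of "A \<union> P"]
    by (simp add: grassmannian_def dimension_def)
qed

lemma plane_subset_iff:
  assumes "P \<in> grassmannian d" "Q \<in> grassmannian d"
  shows "P \<subseteq> Q \<longleftrightarrow> P = Q"
  using assms subspace_dim_equal[of P Q] by (auto simp: grassmannian_def)

text \<open>A nonzero vector common to both would span the line inside \<open>P\<close>. This
  translates non-inclusion, which governs adjacency, into the condition on punctured lines used for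
  counting.\<close>

lemma line_disjoint_iff:
  assumes "L \<in> grassmannian 1" "subspace P"
  shows "L \<inter> P \<subseteq> {0} \<longleftrightarrow> \<not> L \<subseteq> P"
proof
  assume "\<not> L \<subseteq> P"
  show "L \<inter> P \<subseteq> {0}"
  proof (rule ccontr)
    assume "\<not> L \<inter> P \<subseteq> {0}"
    then obtain x where "x \<in> L" "x \<in> P" "x \<noteq> 0" by blast
    then have "span {x} = L" "span {x} \<subseteq> P"
      using assms span_singleton_eq_line[of L x] span_minimal[of "{x}" P] by blast+
    with \<open>\<not> L \<subseteq> P\<close> show False by simp
  qed
next
  assume "L \<inter> P \<subseteq> {0}"
  moreover have "\<not> L \<subseteq> {0}" using assms by (metis (mono_tags) dim_eq_0 grassmannian_def mem_Collect_eq zero_neq_one)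
  ultimately show "\<not> L \<subseteq> P" by blast
qed

lemma card_lines_outside_two_planes:
  assumes d: "dim (UNIV :: 'l set) = 3"
    and P: "P \<in> grassmannian 2" and Q: "Q \<in> grassmannian 2" and "P \<noteq> Q"
  shows "card {L \<in> grassmannian 1. \<not> L \<subseteq> P \<and> \<not> L \<subseteq> Q} = CARD('k) * (CARD('k) - 1)"
proof -
  let ?q = "CARD('k)"
  let ?X = "UNIV - (P \<union> Q)"
  have sub: "subspace P" "subspace Q" "dim P = 2" "dim Q = 2" using P Q by (auto simp: grassmannian_def)
  have q: "?q \<ge> 2" using card_mono[of "UNIV :: 'k set" "{0, 1}"] by simp
  have "span (P \<union> Q) = UNIV"
    using span_Un_plane[OF d Q] plane_subset_iff[OF P Q] \<open>P \<noteq> Q\<close> by blast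
  then have "{x + y |x y. x \<in> P \<and> y \<in> Q} = UNIV"
    using sub by (simp add: span_Un span_eq_iff[THEN iffD2])
  \<comment> \<open>The dimension formula reads 3 + \<open>dim (P \<inter> Q)\<close> = 2 +
    2.\<close>
  then have "dim (P \<inter> Q) = 1"
    using dim_sums_Int[of P Q] sub d by simp
  then have PQ: "card (P \<inter> Q) = ?q"
    using sub card_subspace[of "P \<inter> Q"] by (simp add: subspace_inter)
  have "card (P \<union> Q) + ?q = 2 * ?q\<^sup>2"
    using card_Un_Int[of P Q] sub PQ by (simp add: card_subspace)
  moreover have "card ?X + card (P \<union> Q) = ?q ^ 3"
    using card_subspace[of UNIV] d card_Diff_subset[of "P \<union> Q" UNIV] card_mono[of UNIV "P \<union> Q"]
    by simp
  ultimately have "card ?X + 2 * ?q\<^sup>2 = ?q ^ 3 + ?q" by linarith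
  \<comment> \<open>Substituting \<open>Suc r\<close> removes the truncated subtraction from
    \<open>?q - 1\<close>.\<close>
  moreover obtain r where "?q = Suc r" using q by (cases ?q) auto
  ultimately have X: "card ?X = ?q * (?q - 1) * (?q - 1)"
    by (simp add: power2_eq_square power3_eq_cube algebra_simps)
  have "(?q - 1) * card {L \<in> grassmannian 1. L - {0} \<subseteq> ?X} = card ?X"
  proof (rule card_lines_scaling_closed)
    show "0 \<notin> ?X" using sub by (simp add: subspace_0)
  next
    fix c x assume "c \<noteq> (0::'k)" "x \<in> ?X"
    \<comment> \<open>If \<open>c *s x\<close> were in \<open>P\<close> or \<open>Q\<close>, scaling
      back would put \<open>x\<close> there too.\<close>
    moreover have "x = inverse c *s (c *s x)" using \<open>c \<noteq> 0\<close> by simp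
    ultimately show "c *s x \<in> ?X" using sub by (metis DiffD2 DiffI Un_iff UNIV_I subspace_scale)
  qed
  moreover have "{L \<in> grassmannian 1. L - {0} \<subseteq> ?X} = {L \<in> grassmannian 1. \<not> L \<subseteq> P \<and> \<not> L \<subseteq> Q}"
    using line_disjoint_iff sub by blast
  ultimately show ?thesis using X q by simp
qed

text \<open>The double count is solved for the number of planes by factoring its right-hand side and
  cancelling. This happens in the integers, where subtraction is not truncated; \<open>le\<close>
  justifies the transfer.\<close>

lemma card_planes_3:
  assumes "dim (UNIV :: 'l set) = 3"
  shows "card (grassmannian 2) = CARD('k)\<^sup>2 + CARD('k) + 1"
proof -
  define q where "q = int CARD('k)"
  have q: "CARD('k) \<ge> 2" using card_mono[of "UNIV :: 'k set" "{0, 1}"] by simp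
  then have le: "1 \<le> CARD('k) ^ n" "0 < n \<Longrightarrow> CARD('k) \<le> CARD('k) ^ n" for n
    by (auto simp: self_le_power)
  have "int ((CARD('k)\<^sup>2 - 1) * (CARD('k)\<^sup>2 - CARD('k)) * card (grassmannian 2)) =
    int ((CARD('k) ^ 3 - 1) * (CARD('k) ^ 3 - CARD('k)))"
    using card_planes assms by simp
  then have "(q\<^sup>2 - 1) * (q\<^sup>2 - q) * int (card (grassmannian 2)) = (q ^ 3 - 1) * (q ^ 3 - q)"
    using le by (simp add: of_nat_diff q_def)
  also have "\<dots> = (q\<^sup>2 - 1) * (q\<^sup>2 - q) * (q\<^sup>2 + q + 1)" by algebra
  finally have "(q\<^sup>2 - 1) * (q\<^sup>2 - q) * int (card (grassmannian 2)) =
    (q\<^sup>2 - 1) * (q\<^sup>2 - q) * (q\<^sup>2 + q + 1)" .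
  \<comment> \<open>In the factored form no factor vanishes for q \<ge> 2, so cancellation is
    allowed.\<close>
  moreover have "(q\<^sup>2 - 1) * (q\<^sup>2 - q) = (q - 1) * (q + 1) * (q * (q - 1))" by algebra
  then have "(q\<^sup>2 - 1) * (q\<^sup>2 - q) \<noteq> 0" using q by (simp add: q_def)
  ultimately have "int (card (grassmannian 2)) = int (CARD('k)\<^sup>2 + CARD('k) + 1)"
    by (simp add: q_def)
  then show ?thesis by (simp only: of_nat_eq_iff)
qed

end

section \<open>The comaximal graph and the closed formula\<close>

text \<open>Small \<open>n\<close> needs no exception, as one of the factors is then zero.\<close>

lemma choose_3_real: "real (n choose 3) = real n * (real n - 1) * (real n - 2) / 6"
  unfolding binomial_gbinomial gbinomial_prod_rev
  by (simp add: numeral_eq_Suc algebra_simps)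

lemma choose_2_real: "real (n choose 2) = real n * (real n - 1) / 2"
  unfolding binomial_gbinomial gbinomial_prod_rev
  by (simp add: numeral_eq_Suc algebra_simps)

theorem proposition3p2:
  fixes scale :: "'k::{field,finite} \<Rightarrow> 'l::ab_group_add \<Rightarrow> 'l"
    and bracket :: "'l \<Rightarrow> 'l \<Rightarrow> 'l"
    and q :: nat
  assumes "q = CARD('k)"
    and "lie_algebra scale bracket"
    and "lie_algebra.abelian bracket"
    and "vector_space.dim scale (UNIV :: 'l set) = 3"
  shows "real (num_triangles (lie_algebra.comaximal_graph scale bracket)) =
    real q * (real q + 1) * (4 * real q ^ 4 + 2 * real q ^ 3 + real q ^ 2 - 3 * real q - 1) / 6"
proof -
  interpret lie_algebra scale bracket by fact
  have d: "dim UNIV = 3" by fact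
  obtain B where B: "independent B" "span B = UNIV" "card B = 3"
    using basis_exists[of UNIV] d by (metis top.extremum_uniqueI)
  \<comment> \<open>Finiteness of \<open>B\<close> follows from its positive cardinality, because
    \<open>card\<close> is 0 on infinite sets.\<close>
  interpret finite_field_space scale B
    by unfold_locales (use B in \<open>auto intro: card_ge_0_finite\<close>)
  have br: "bracket x y = 0" for x y using assms(3) by (simp add: abelian_def)
  have subalg: "lie_subalgebra S \<longleftrightarrow> subspace S" for S
    by (auto simp: lie_subalgebra_def br subspace_0)
  \<comment> \<open>As an equality of predicates, this turns the hull defining
    \<open>lie_span\<close> into the one defining \<open>span\<close>.\<close>
  then have "lie_subalgebra = subspace" by blast
  then have lspan: "lie_span X = span X" for X by (simp add: lie_span_def span_def)
  have verts: "comaximal_vertices = grassmannian 1 \<union> grassmannian 2"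
  proof (intro set_eqI iffI)
    fix A assume "A \<in> comaximal_vertices"
    then have A: "subspace A" "A \<noteq> {0}" "A \<noteq> UNIV" by (auto simp: comaximal_vertices_def subalg)
    then have "dim A \<noteq> 0" using subspace_0 by (metis dim_eq_0 empty_iff subset_singletonD)
    moreover have "dim A < 3"
      using A d dim_subset[of A UNIV] subspace_dim_equal[of A UNIV] by fastforce
    ultimately have "dim A = 1 \<or> dim A = 2" by linarith
    then show "A \<in> grassmannian 1 \<union> grassmannian 2" using A by (auto simp: grassmannian_def)
  next
    fix A assume "A \<in> grassmannian 1 \<union> grassmannian 2"
    then show "A \<in> comaximal_vertices"
      using d by (auto simp: comaximal_vertices_def subalg grassmannian_def)
  qed
  have edge: "{A, C} \<in> comaximal_edges \<longleftrightarrow> span (A \<union> C) = UNIV"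
    if "A \<in> comaximal_vertices" "C \<in> comaximal_vertices" "A \<noteq> C" for A C
    using that by (auto simp: comaximal_edges_def lspan doubleton_eq_iff Un_commute)
  have disj: "grassmannian 1 \<inter> grassmannian 2 = {}" by (auto simp: grassmannian_def)
  have LL: "{A, C} \<notin> comaximal_edges"
    if A: "A \<in> grassmannian 1" and C: "C \<in> grassmannian 1" and "A \<noteq> C" for A C
  proof
    assume "{A, C} \<in> comaximal_edges"
    then have "span (A \<union> C) = UNIV" using that edge verts by blast
    then have "{x + y |x y. x \<in> A \<and> y \<in> C} = UNIV"
      using that by (simp add: span_Un grassmannian_def span_eq_iff[THEN iffD2])
    \<comment> \<open>The sum of two lines has dimension at most 2.\<close>
    then show False
      using dim_sums_Int[of A C] A C d by (simp add: grassmannian_def)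
  qed
  \<comment> \<open>Here \<open>A\<close> may be a line or a plane, so this serves both
    \<open>PP\<close> and \<open>LPP\<close>.\<close>
  have edge_plane: "{A, P} \<in> comaximal_edges \<longleftrightarrow> \<not> A \<subseteq> P"
    if "A \<in> comaximal_vertices" "P \<in> grassmannian 2" "A \<noteq> P" for A P
  proof
    assume "{A, P} \<in> comaximal_edges"
    then have "span (A \<union> P) = UNIV" using that edge verts by blast
    moreover have "dim P = 2" "subspace P" using that by (auto simp: grassmannian_def)
    \<comment> \<open>If \<open>A\<close> were inside \<open>P\<close>, the span of the union would
      be \<open>P\<close>, of dimension 2 instead of 3.\<close>
    ultimately show "\<not> A \<subseteq> P"
      using d by (metis Un_absorb1 dim_span numeral_eq_iff semiring_norm(88))
  next
    assume "\<not> A \<subseteq> P"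
    then show "{A, P} \<in> comaximal_edges" using that edge verts span_Un_plane[OF d] by blast
  qed
  have PP: "{P, Q} \<in> comaximal_edges"
    if "P \<in> grassmannian 2" "Q \<in> grassmannian 2" "P \<noteq> Q" for P Q
    using that edge_plane[of P Q] plane_subset_iff[of P 2 Q] verts by simp
  have LPP: "card {L \<in> grassmannian 1. {L, P} \<in> comaximal_edges \<and> {L, Q} \<in> comaximal_edges} =
      q * (q - 1)"
    if "P \<in> grassmannian 2" "Q \<in> grassmannian 2" "P \<noteq> Q" for P Q
  proof -
    \<comment> \<open>Disjointness of the two vertex classes supplies the distinctness that
      \<open>edge_plane\<close> asks for.\<close>
    have "{L, R} \<in> comaximal_edges \<longleftrightarrow> \<not> L \<subseteq> R"
      if "L \<in> grassmannian 1" "R \<in> grassmannian 2" for L R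
      using that edge_plane[of L R] disj verts by auto
    then have "{L \<in> grassmannian 1. {L, P} \<in> comaximal_edges \<and> {L, Q} \<in> comaximal_edges} =
        {L \<in> grassmannian 1. \<not> L \<subseteq> P \<and> \<not> L \<subseteq> Q}"
      using that by blast
    then show ?thesis using card_lines_outside_two_planes[OF d that] assms(1) by simp
  qed
  have "num_triangles comaximal_graph =
      (card (grassmannian 2) choose 3) + (card (grassmannian 2) choose 2) * (q * (q - 1))"
    unfolding comaximal_graph_def verts
    by (rule num_triangles_split) (use disj LL PP LPP in auto)
  moreover have "card (grassmannian 2) = q\<^sup>2 + q + 1" using card_planes_3[OF d] assms(1) by simp
  \<comment> \<open>Needed so that \<open>real (q - 1)\<close> becomes
    \<open>real q - 1\<close>.\<close>
  moreover have "q \<ge> 1" using assms(1) by (simp add: Suc_leI)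
  ultimately have "real (num_triangles comaximal_graph) =
      (real q ^ 2 + real q + 1) * (real q ^ 2 + real q) * (real q ^ 2 + real q - 1) / 6 +
      (real q ^ 2 + real q + 1) * (real q ^ 2 + real q) / 2 * (real q * (real q - 1))"
    by (simp add: choose_3_real choose_2_real add.commute)
  \<comment> \<open>After extracting q (q + 1) / 6, what remains is (q^2 + q + 1) (4 q^2 - 2 q - 1),
    which expands to the quartic in the claim.\<close>
  then show ?thesis by (simp add: field_simps power2_eq_square power3_eq_cube power4_eq_xxxx)
qed

end
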